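(* Let $n, k \in \mathbb{N}$, write $[n] = \{1, 2, \ldots, n\}$, and let $X_1, \ldots, X_N$ and $Y_1, \ldots, Y_N$ be $k$-element subsets of $[n]$ such that $X_i \cap Y_j = \emptyset$ for all $1 \leq i, j \leq N$. Suppose that for all $i \neq j$, \[ |X_i \cap X_j| + |Y_i \cap Y_j| = k. \] Then $N \leq n$ for all $k$. Moreover, if $n > k4^{k}$, then $N \leq \left\lfloor \frac{n+2-k}{k} \right\rfloor$, and families of sets attaining this bound may be constructed explicitly.
   Context: For $n, k \in \mathbb{N}$, the notation $\mathcal{V}(n,k)$ in the paper denotes the set of all $k$-element subsets of $[n] = \{1, \ldots, n\}$; the sets $X_i, Y_i$ in the theorem are elements of this collection.
   Formalization: Takes k ≥ 1, and asserts that families attain the bound only when (n mod k) + 2 < k; otherwise the bound is never attained for n > k4^k, since then k(N+1) ≤ n (e.g. k = 1 gives bound n+1 > n; k = 2 gives N ≤ ⌊n/2⌋ − 1). *)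

theory Defs
  imports Complex_Main
begin

definition k_subsets :: "nat \<Rightarrow> nat \<Rightarrow> nat set set" where
  "k_subsets n k = {A. A \<subseteq> {1..n} \<and> card A = k}"

(* The families are indexed by {1..N}; values of X and Y outside this range are irrelevant,
   and the indexed sets are not required to be distinct. *)
definition admissible ::
    "nat \<Rightarrow> nat \<Rightarrow> nat \<Rightarrow> (nat \<Rightarrow> nat set) \<Rightarrow> (nat \<Rightarrow> nat set) \<Rightarrow> bool" where
  "admissible n k N X Y \<longleftrightarrow>
     (\<forall>i\<in>{1..N}. X i \<in> k_subsets n k \<and> Y i \<in> k_subsets n k) \<and>
     (\<forall>i\<in>{1..N}. \<forall>j\<in>{1..N}. X i \<inter> Y j = {}) \<and>
     (\<forall>i\<in>{1..N}. \<forall>j\<in>{1..N}. i \<noteq> j \<longrightarrow> card (X i \<inter> X j) + card (Y i \<inter> Y j) = k)"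

end

theory Submission
  imports Defs
begin

text \<open>
  The sets $Z_i = X_i \cup Y_i$ have size $2k$ and meet pairwise in $k$ points, so that
  $\| \sum_i c_i 1_{Z_i} \|^2 = k \sum_i c_i^2 + k (\sum_i c_i)^2$. Comparing this with the
  square of the single coordinate at a point $p$ of degree $d$, for the best choice of the
  weights (proportional to $N + 1 - d$ on the sets containing $p$ and to $-d$ on the others),
  gives $d (N + 1 - d) \le k (N + 1)$. Summed over all $n$ points, this is $N \le n$.
  If $N > k^2 + 2k$, it forces $d \le k$ or $d \ge N + 1 - k$ at every point; counting shows that
  exactly $k$ points are of the second kind and that they lie in every $Z_i$. Hence the $Z_i$ form
  a sunflower with a kernel of size $k$, and $k (N + 1) \le n$.
\<close>

section \<open>Incidence counts in a family of 2k-sets meeting pairwise in k points\<close>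

locale half_intersecting_family =
  fixes I :: "'i set" and V :: "'a set" and Z :: "'i \<Rightarrow> 'a set" and k :: nat
  assumes finite_I: "finite I" and finite_V: "finite V" and k_pos: "k \<ge> 1"
    and Z_subset: "i \<in> I \<Longrightarrow> Z i \<subseteq> V"
    and card_Z: "i \<in> I \<Longrightarrow> card (Z i) = 2 * k"
    and card_Z_inter: "i \<in> I \<Longrightarrow> j \<in> I \<Longrightarrow> i \<noteq> j \<Longrightarrow> card (Z i \<inter> Z j) = k"
begin

definition deg :: "'a \<Rightarrow> nat" where
  "deg p = card {i \<in> I. p \<in> Z i}"

lemma sum_of_bool_deg: "(\<Sum>i\<in>I. of_bool (p \<in> Z i)) = (of_nat (deg p) :: 'b :: semiring_1)"
  unfolding deg_def using finite_I by (simp add: Int_def)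

lemma deg_le: "deg p \<le> card I"
  unfolding deg_def using finite_I by (intro card_mono) auto

lemma finite_Z: "i \<in> I \<Longrightarrow> finite (Z i)"
  using Z_subset finite_V finite_subset by blast

lemma sum_deg:
  assumes "finite S"
  shows "(\<Sum>p\<in>S. deg p) = (\<Sum>i\<in>I. card (Z i \<inter> S))"
proof -
  have "(\<Sum>p\<in>S. deg p) = (\<Sum>p\<in>S. \<Sum>i\<in>I. of_bool (p \<in> Z i))"
    by (simp only: sum_of_bool_deg of_nat_id)
  also have "\<dots> = (\<Sum>i\<in>I. \<Sum>p\<in>S. of_bool (p \<in> Z i))"
    by (rule sum.swap)
  also have "\<dots> = (\<Sum>i\<in>I. card (Z i \<inter> S))"
    using assms by (simp add: Int_commute)
  finally show ?thesis .
qed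

lemma sum_deg_V: "(\<Sum>p\<in>V. deg p) = 2 * k * card I"
proof -
  have "(\<Sum>p\<in>V. deg p) = (\<Sum>i\<in>I. 2 * k)"
    unfolding sum_deg[OF finite_V]
    by (rule sum.cong) (use Z_subset card_Z in \<open>simp_all add: Int_absorb2\<close>)
  then show ?thesis by simp
qed

text \<open>Double counting of incidences with \<open>Z i\<close>: the set itself contributes 2k and
  each other member k.\<close>

lemma sum_deg_Z:
  assumes "i \<in> I"
  shows "(\<Sum>p\<in>Z i. deg p) = k * (card I + 1)"
proof -
  have "(\<Sum>p\<in>Z i. deg p) = (\<Sum>j\<in>I. card (Z j \<inter> Z i))"
    by (rule sum_deg[OF finite_Z[OF assms]])
  also have "\<dots> = (\<Sum>j\<in>I. k + (if j = i then k else 0))"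
    by (rule sum.cong) (use assms card_Z card_Z_inter in auto)
  also have "\<dots> = k * (card I + 1)"
    using assms finite_I by (simp add: sum.distrib)
  finally show ?thesis .
qed

section \<open>Gram matrix of the indicator vectors and the Fisher-type inequality\<close>

text \<open>The Gram matrix of the indicator vectors is k times (identity + all-ones matrix); this
  is its quadratic form.\<close>

lemma norm_weighted_sum:
  fixes c :: "'i \<Rightarrow> int"
  shows "(\<Sum>p\<in>V. (\<Sum>i\<in>I. c i * of_bool (p \<in> Z i))\<^sup>2) =
    int k * (\<Sum>i\<in>I. (c i)\<^sup>2) + int k * (\<Sum>i\<in>I. c i)\<^sup>2"
proof -
  have inter: "(\<Sum>p\<in>V. of_bool (p \<in> Z i) * of_bool (p \<in> Z j)) =
      (int k + (if i = j then int k else 0))" if "i \<in> I" "j \<in> I" for i j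
  proof -
    have "(\<Sum>p\<in>V. of_bool (p \<in> Z i) * of_bool (p \<in> Z j)) =
        (\<Sum>p\<in>V. if p \<in> Z i \<inter> Z j then 1 else (0 :: int))"
      by (rule sum.cong) auto
    also have "\<dots> = int (card (Z i \<inter> Z j))"
    proof -
      have "V \<inter> (Z i \<inter> Z j) = Z i \<inter> Z j"
        using Z_subset that by auto
      then show ?thesis
        using sum.inter_restrict[OF finite_V, of "\<lambda>_. 1 :: int" "Z i \<inter> Z j"] by simp
    qed
    finally show ?thesis
      using card_Z card_Z_inter that by (cases "i = j") auto
  qed
  have "(\<Sum>p\<in>V. (\<Sum>i\<in>I. c i * of_bool (p \<in> Z i))\<^sup>2) =
      (\<Sum>p\<in>V. \<Sum>i\<in>I. \<Sum>j\<in>I. c i * c j * (of_bool (p \<in> Z i) * of_bool (p \<in> Z j)))"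
    unfolding power2_eq_square sum_product by (simp only: mult_ac)
  also have "\<dots> = (\<Sum>i\<in>I. \<Sum>p\<in>V. \<Sum>j\<in>I. c i * c j * (of_bool (p \<in> Z i) * of_bool (p \<in> Z j)))"
    by (rule sum.swap)
  also have "\<dots> = (\<Sum>i\<in>I. \<Sum>j\<in>I. \<Sum>p\<in>V. c i * c j * (of_bool (p \<in> Z i) * of_bool (p \<in> Z j)))"
    by (intro sum.cong refl sum.swap)
  also have "\<dots> = (\<Sum>i\<in>I. \<Sum>j\<in>I. c i * c j * (int k + (if i = j then int k else 0)))"
    by (intro sum.cong refl) (simp only: sum_distrib_left[symmetric] inter)
  also have "\<dots> = (\<Sum>i\<in>I. \<Sum>j\<in>I. int k * (c i * c j) + (if i = j then int k * (c i)\<^sup>2 else 0))"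
    by (intro sum.cong refl) (auto simp: algebra_simps power2_eq_square)
  also have "\<dots> = int k * (\<Sum>i\<in>I. c i)\<^sup>2 + int k * (\<Sum>i\<in>I. (c i)\<^sup>2)"
    using finite_I
    by (simp add: sum.distrib power2_eq_square sum_product flip: sum_distrib_left)
  finally show ?thesis by simp
qed

lemma deg_bound:
  assumes "p \<in> V"
  shows "int (deg p) * (int (card I) + 1 - int (deg p)) \<le> int k * (int (card I) + 1)"
proof (cases "deg p = 0")
  case False
  define d where "d = int (deg p)"
  define e where "e = int (card I) - d"
  \<comment> \<open>Up to scaling, these weights are (identity + all-ones)^(-1) applied to the
    incidence vector of \<open>p\<close>; here 1 + e = N + 1 - d with N =
    \<open>card I\<close>.\<close>
  define c where "c i = (if p \<in> Z i then 1 + e else - d)" for i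
  have d: "d > 0" and e: "e \<ge> 0"
    using False deg_le[of p] by (auto simp: d_def e_def)
  have sum_split: "(\<Sum>i\<in>I. if p \<in> Z i then a else b) = d * a + e * b" for a b :: int
  proof -
    have "card (I \<inter> - {i. p \<in> Z i}) = card I - deg p"
    proof -
      have "I \<inter> - {i. p \<in> Z i} = I - {i \<in> I. p \<in> Z i}" by auto
      then show ?thesis
        unfolding deg_def using finite_I by (simp add: card_Diff_subset)
    qed
    moreover have "card (I \<inter> {i. p \<in> Z i}) = deg p"
      unfolding deg_def by (rule arg_cong[where f = card]) auto
    ultimately show ?thesis
      using finite_I deg_le[of p] by (simp add: sum.If_cases d_def e_def of_nat_diff)
  qed
  have c1: "(\<Sum>i\<in>I. c i) = d"
    unfolding c_def sum_split by (simp add: algebra_simps)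
  have "(\<Sum>i\<in>I. (c i)\<^sup>2) = (\<Sum>i\<in>I. if p \<in> Z i then (1 + e)\<^sup>2 else d\<^sup>2)"
    unfolding c_def by (rule sum.cong) auto
  then have c2: "(\<Sum>i\<in>I. (c i)\<^sup>2) = d * (1 + e)\<^sup>2 + e * d\<^sup>2"
    unfolding sum_split .
  have "(\<Sum>i\<in>I. c i * of_bool (p \<in> Z i)) = (\<Sum>i\<in>I. if p \<in> Z i then 1 + e else 0)"
    unfolding c_def by (rule sum.cong) auto
  then have "(d * (1 + e))\<^sup>2 = (\<Sum>i\<in>I. c i * of_bool (p \<in> Z i))\<^sup>2"
    unfolding sum_split by simp
  also have "\<dots> \<le> (\<Sum>q\<in>V. (\<Sum>i\<in>I. c i * of_bool (q \<in> Z i))\<^sup>2)"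
    using assms finite_V by (intro member_le_sum) auto
  also have "\<dots> = int k * (d * (1 + e)\<^sup>2 + e * d\<^sup>2) + int k * d\<^sup>2"
    unfolding norm_weighted_sum c1 c2 ..
  also have "\<dots> = (d * (1 + e)) * (int k * (d + e + 1))"
    by (simp add: algebra_simps power2_eq_square)
  finally have "(d * (1 + e)) * (d * (1 + e)) \<le> (d * (1 + e)) * (int k * (d + e + 1))"
    by (simp add: power2_eq_square)
  \<comment> \<open>Positivity allows cancelling this factor; degree 0 was split off for this
    reason.\<close>
  moreover have "0 < d * (1 + e)" using d e by simp
  ultimately have "d * (1 + e) \<le> int k * (d + e + 1)"
    by (rule mult_left_le_imp_le)
  then show ?thesis by (simp add: e_def d_def algebra_simps)
qed simp

text \<open>With N = \<open>card I\<close>, the degrees have first moment 2kN and second moment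
  kN(N+1). Summing \<open>deg_bound\<close> over \<open>V\<close> therefore leaves exactly k(N+1)N
  on the left.\<close>

theorem fisher_bound: "card I \<le> card V"
proof -
  define N where "N = int (card I)"
  have "(\<Sum>p\<in>V. (int (deg p))\<^sup>2) = int k * N * (N + 1)"
  proof -
    \<comment> \<open>Degrees are the coordinates of the sum with all weights 1.\<close>
    have "(\<Sum>p\<in>V. (int (deg p))\<^sup>2) = (\<Sum>p\<in>V. (\<Sum>i\<in>I. 1 * of_bool (p \<in> Z i))\<^sup>2)"
      by (simp only: mult_1 sum_of_bool_deg)
    then show ?thesis
      unfolding norm_weighted_sum by (simp add: N_def power2_eq_square algebra_simps)
  qed
  moreover have "(\<Sum>p\<in>V. int (deg p)) = 2 * int k * N"
    using arg_cong[OF sum_deg_V, of int] by (simp add: N_def)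
  moreover have "(\<Sum>p\<in>V. int (deg p) * (N + 1 - int (deg p))) =
      (N + 1) * (\<Sum>p\<in>V. int (deg p)) - (\<Sum>p\<in>V. (int (deg p))\<^sup>2)"
    by (simp add: sum_distrib_left sum_subtractf[symmetric] power2_eq_square algebra_simps)
  ultimately have "int k * (N + 1) * N = (\<Sum>p\<in>V. int (deg p) * (N + 1 - int (deg p)))"
    by (simp add: algebra_simps)
  also have "\<dots> \<le> (\<Sum>p\<in>V. int k * (N + 1))"
    using deg_bound by (intro sum_mono) (simp add: N_def)
  also have "\<dots> = int k * (N + 1) * int (card V)" by simp
  finally have "int k * (N + 1) * N \<le> int k * (N + 1) * int (card V)" .
  moreover have "0 < int k * (N + 1)" using k_pos by (simp add: N_def)
  ultimately have "N \<le> int (card V)" by (rule mult_left_le_imp_le)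
  then show ?thesis by (simp add: N_def)
qed

section \<open>Large families are sunflowers\<close>

text \<open>By concavity, d(N+1-d) is at least (k+1)(N-k) for k+1 \<le> d \<le> N-k. This exceeds
  the k(N+1) of \<open>deg_bound\<close> exactly when N > k^2 + 2k.\<close>

lemma deg_dichotomy:
  assumes "card I > k\<^sup>2 + 2 * k" "p \<in> V" "deg p > k"
  shows "int (deg p) \<ge> int (card I) + 1 - int k"
proof (rule ccontr)
  \<comment> \<open>Distances of d from the two ends of the forbidden range; u * v = d(N+1-d) -
    (k+1)(N-k).\<close>
  define u v where "u = int (deg p) - int k - 1" and "v = int (card I) - int k - int (deg p)"
  assume "\<not> ?thesis"
  then have "u \<ge> 0" "v \<ge> 0" using assms(3) by (auto simp: u_def v_def)
  then have "0 \<le> u * v" by simp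
  then have "(int k + 1) * (int (card I) - int k) \<le> int (deg p) * (int (card I) + 1 - int (deg p))"
    by (simp add: u_def v_def algebra_simps)
  with deg_bound[OF assms(2)]
  have "(int k + 1) * (int (card I) - int k) \<le> int k * (int (card I) + 1)" by linarith
  then have "int (card I) \<le> (int k)\<^sup>2 + 2 * int k"
    by (simp add: algebra_simps power2_eq_square)
  then have "int (card I) \<le> int (k\<^sup>2 + 2 * k)" by simp
  with assms(1) show False by linarith
qed

text \<open>The degrees along \<open>Z i\<close> sum to k(N+1). Large ones lie in [N+1-k, N] and
  small ones in [1, k], so k+1 large degrees would give too much and k-1 too little.\<close>

lemma card_large_degree:
  assumes big: "card I > k\<^sup>2 + 2 * k" and i: "i \<in> I"
  shows "card (Z i \<inter> {p \<in> V. deg p > k}) = k"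
proof -
  define N K where "N = int (card I)" and "K = int k"
  let ?L = "Z i \<inter> {p \<in> V. deg p > k}" and ?S = "Z i - {p \<in> V. deg p > k}"
  define b where "b = int (card ?L)"
  have NK: "N > K * K + 2 * K" and K: "K \<ge> 1"
  proof -
    have "int (k\<^sup>2 + 2 * k) < int (card I)" using big by linarith
    then show "N > K * K + 2 * K" by (simp add: N_def K_def power2_eq_square)
    show "K \<ge> 1" using k_pos by (simp add: K_def)
  qed
  have S: "int (card ?S) = 2 * K - b"
  proof -
    have "card (Z i) = card ?L + card ?S"
      using finite_Z[OF i] by (subst card_Un_disjoint[symmetric]) (auto intro: arg_cong[where f = card])
    then show ?thesis using card_Z[OF i] by (simp add: b_def K_def)
  qed
  have "(\<Sum>p\<in>Z i. int (deg p)) = (\<Sum>p\<in>?L. int (deg p)) + (\<Sum>p\<in>?S. int (deg p))"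
    using finite_Z[OF i] by (rule sum.Int_Diff)
  moreover have "(\<Sum>p\<in>Z i. int (deg p)) = K * (N + 1)"
    using arg_cong[OF sum_deg_Z[OF i], of int] by (simp add: N_def K_def algebra_simps)
  ultimately have total: "K * (N + 1) = (\<Sum>p\<in>?L. int (deg p)) + (\<Sum>p\<in>?S. int (deg p))"
    by simp
  have L_lower: "b * (N + 1 - K) \<le> (\<Sum>p\<in>?L. int (deg p))"
    unfolding b_def N_def K_def using deg_dichotomy[OF big] by (intro sum_bounded_below) auto
  have L_upper: "(\<Sum>p\<in>?L. int (deg p)) \<le> b * N"
    unfolding b_def N_def using deg_le by (intro sum_bounded_above) simp
  have S_lower: "(2 * K - b) * 1 \<le> (\<Sum>p\<in>?S. int (deg p))"
    unfolding S[symmetric]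
  proof (rule sum_bounded_below)
    fix p assume "p \<in> ?S"
    then have "{j \<in> I. p \<in> Z j} \<noteq> {}" using i by auto
    then show "1 \<le> int (deg p)"
      using finite_I by (simp add: deg_def Suc_le_eq card_gt_0_iff)
  qed
  have S_upper: "(\<Sum>p\<in>?S. int (deg p)) \<le> (2 * K - b) * K"
    unfolding S[symmetric] unfolding K_def using Z_subset[OF i] by (intro sum_bounded_above) auto
  \<comment> \<open>The two estimates of the total are b(N-K) + 2K from below and b(N-K) + 2K^2 from
    above, so both are monotone in b.\<close>
  have NK': "N - K \<ge> 0"
    using NK K by (smt (verit) mult_nonneg_nonneg)
  have "b \<le> K"
  proof (rule ccontr)
    assume "\<not> b \<le> K"
    then have "(K + 1) * (N - K) \<le> b * (N - K)" using NK' by (intro mult_right_mono) auto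
    with total L_lower S_lower have "(K + 1) * (N - K) + 2 * K \<le> K * (N + 1)"
      by (simp add: algebra_simps)
    then show False using NK K by (simp add: algebra_simps)
  qed
  moreover have "b \<ge> K"
  proof (rule ccontr)
    assume "\<not> b \<ge> K"
    then have "b * (N - K) \<le> (K - 1) * (N - K)" using NK' by (intro mult_right_mono) auto
    with total L_upper S_upper have "K * (N + 1) \<le> (K - 1) * (N - K) + 2 * K * K"
      by (simp add: algebra_simps)
    then show False using NK K by (simp add: algebra_simps)
  qed
  ultimately show ?thesis by (simp add: b_def K_def)
qed

text \<open>The kernel consists of the points of degree above k. Each member meets it in k points,
  so its degrees sum to kN; as each is at least N+1-k, there is no room for k+1 such points.\<close>

theorem sunflower_kernel:
  assumes big: "card I > k\<^sup>2 + 2 * k"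
  obtains P where "card P = k" "\<And>i. i \<in> I \<Longrightarrow> P \<subseteq> Z i"
proof -
  define P where "P = {p \<in> V. deg p > k}"
  have fin: "finite P" using finite_V by (simp add: P_def)
  have P_Z: "card (Z i \<inter> P) = k" if "i \<in> I" for i
    using card_large_degree[OF big that] by (simp add: P_def)
  have "card P \<le> k"
  proof (rule ccontr)
    define N K where "N = int (card I)" and "K = int k"
    assume "\<not> card P \<le> k"
    have "int (k\<^sup>2 + 2 * k) < int (card I)" using big by linarith
    then have NK: "N > K * K + 2 * K" by (simp add: N_def K_def power2_eq_square)
    have K: "K \<ge> 1" using k_pos by (simp add: K_def)
    have "(\<Sum>p\<in>P. deg p) = k * card I"
      unfolding sum_deg[OF fin] by (simp add: P_Z)
    from arg_cong[OF this, of int] have "(\<Sum>p\<in>P. int (deg p)) = K * N"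
      by (simp add: N_def K_def)
    moreover have "int (card P) * (N + 1 - K) \<le> (\<Sum>p\<in>P. int (deg p))"
      unfolding N_def K_def P_def using deg_dichotomy[OF big] by (intro sum_bounded_below) auto
    moreover have "(K + 1) * (N + 1 - K) \<le> int (card P) * (N + 1 - K)"
    proof (rule mult_right_mono)
      show "K + 1 \<le> int (card P)" using \<open>\<not> card P \<le> k\<close> by (simp add: K_def)
      show "0 \<le> N + 1 - K" using NK K by (smt (verit) mult_nonneg_nonneg)
    qed
    ultimately have "(K + 1) * (N + 1 - K) \<le> K * N" by linarith
    then show False using NK K by (simp add: algebra_simps)
  qed
  have sub: "P \<subseteq> Z i" if "i \<in> I" for i
  proof -
    have "Z i \<inter> P = P"
      using \<open>card P \<le> k\<close> P_Z[OF that] fin by (intro card_seteq) auto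
    then show ?thesis by auto
  qed
  \<comment> \<open>One member suffices for the exact size, since \<open>Z i \<inter> P\<close> has
    k points and equals \<open>P\<close>.\<close>
  obtain i where "i \<in> I" using big by fastforce
  then have "card P = k" using P_Z sub by (metis inf.absorb_iff2 inf_commute)
  then show ?thesis using sub that by blast
qed

text \<open>The kernel and the N petals \<open>Z i - P\<close> are pairwise disjoint sets of k
  points inside \<open>V\<close>.\<close>

theorem sunflower_bound:
  assumes big: "card I > k\<^sup>2 + 2 * k"
  shows "k * (card I + 1) \<le> card V"
proof -
  obtain P where P: "card P = k" and sub: "\<And>i. i \<in> I \<Longrightarrow> P \<subseteq> Z i"
    using sunflower_kernel[OF big] by blast
  have fin: "finite P" using P k_pos card.infinite by fastforce
  obtain i0 where "i0 \<in> I" using big by fastforce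
  then have PV: "P \<subseteq> V" using sub Z_subset by blast
  have inter: "Z i \<inter> Z j = P" if "i \<in> I" "j \<in> I" "i \<noteq> j" for i j
    using that sub card_Z_inter finite_Z P by (intro card_seteq[symmetric]) auto
  have "card (\<Union>i\<in>I. Z i - P) = (\<Sum>i\<in>I. card (Z i - P))"
    using finite_I finite_Z inter by (intro card_UN_disjoint) auto
  also have "\<dots> = (\<Sum>i\<in>I. k)"
    using sub P fin card_Z by (intro sum.cong) (auto simp: card_Diff_subset)
  finally have "card (P \<union> (\<Union>i\<in>I. Z i - P)) = k + card I * k"
    using P fin finite_I finite_Z by (subst card_Un_disjoint) auto
  moreover have "card (P \<union> (\<Union>i\<in>I. Z i - P)) \<le> card V"
    using finite_V PV Z_subset by (intro card_mono) auto
  ultimately show ?thesis by (simp add: algebra_simps)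
qed

end

section \<open>Passage from pairs of families to unions, and an extremal example\<close>

text \<open>Disjointness of every X from every Y removes the cross terms, so sizes of unions and of
  their intersections simply add.\<close>

lemma half_intersecting_family_admissible:
  assumes "admissible n k N X Y" "k \<ge> 1"
  shows "half_intersecting_family {1..N} {1..n} (\<lambda>i. X i \<union> Y i) k"
proof
  fix i assume i: "i \<in> {1..N}"
  have fin: "finite (X i)" "finite (Y i)"
    using assms i unfolding admissible_def k_subsets_def by (auto intro!: card_ge_0_finite)
  show "X i \<union> Y i \<subseteq> {1..n}" "card (X i \<union> Y i) = 2 * k"
    using assms i fin unfolding admissible_def k_subsets_def
    by (auto simp: card_Un_disjoint)
  fix j assume j: "j \<in> {1..N}" "i \<noteq> j"
  have "(X i \<union> Y i) \<inter> (X j \<union> Y j) = (X i \<inter> X j) \<union> (Y i \<inter> Y j)"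
    and "(X i \<inter> X j) \<inter> (Y i \<inter> Y j) = {}"
    using assms i j(1) unfolding admissible_def by blast+
  then show "card ((X i \<union> Y i) \<inter> (X j \<union> Y j)) = k"
    using assms i j fin unfolding admissible_def by (simp add: card_Un_disjoint)
qed (use assms in auto)

text \<open>Links the sunflower threshold k^2 + 2k = (k+1)^2 - 1 to the hypothesis n > k
  4^k.\<close>

lemma Suc_squared_le_four_power: "(k + 1)\<^sup>2 \<le> (4 :: nat) ^ k"
proof -
  have "k + 1 \<le> 2 ^ k" using less_exp[of k] by (simp add: Suc_le_eq)
  then have "(k + 1)\<^sup>2 \<le> (2 ^ k)\<^sup>2" by (rule power_mono) simp
  also have "\<dots> = 4 ^ k" by (simp add: power2_eq_square flip: power_mult_distrib)
  finally show ?thesis .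
qed

text \<open>Consecutive blocks of length k: block 0 is every X and blocks 1 to N are the Y's, the
  last ending at k(N+1). The X's share k points and the Y's none.\<close>

lemma admissible_sunflower:
  assumes "k * (N + 1) \<le> n"
  shows "admissible n k N (\<lambda>_. {1..k}) (\<lambda>i. {i * k + 1..i * k + k})"
proof -
  have less: "i * k + k \<le> j * k" if "i < j" for i j :: nat
    using mult_le_mono1[of "Suc i" j k] that by simp
  have "i * k + k \<le> n" "k \<le> n" if "i \<in> {1..N}" for i
  proof -
    have "i * k + k \<le> (N + 1) * k" using that by (intro less) simp
    with assms show "i * k + k \<le> n" by (simp only: mult.commute)
    then show "k \<le> n" by simp
  qed
  moreover have "{i * k + 1..i * k + k} \<inter> {j * k + 1..j * k + k} = {}" if "i \<noteq> j" for i j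
  proof (cases "i < j")
    case True
    from less[OF this] show ?thesis by auto
  next
    case False
    with that have "j < i" by simp
    from less[OF this] show ?thesis by auto
  qed
  moreover have "{1..k} \<inter> {j * k + 1..j * k + k} = {}" if "j \<in> {1..N}" for j
    using that by (cases j) auto
  ultimately show ?thesis
    unfolding admissible_def k_subsets_def
    by (intro conjI ballI impI) (simp_all del: Int_atLeastAtMost)
qed

text \<open>For n > k 4^k the proof yields N \<le> n div k - 1, a value the blocks attain. The floor
  equals \<lfloor>(n+2)/k\<rfloor> - 1, which agrees with it exactly when n mod k + 2 < k; hence the
  condition on attainment.\<close>

theorem theorem2p3:
  fixes n k :: nat
  assumes "n \<ge> 1" and "k \<ge> 1"
  shows "(\<forall>N X Y. admissible n k N X Y \<longrightarrow> N \<le> n) \<and>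
         (n > k * 4 ^ k \<longrightarrow>
            (\<forall>N X Y. admissible n k N X Y \<longrightarrow>
               int N \<le> \<lfloor>(real n + 2 - real k) / real k\<rfloor>) \<and>
            (n mod k + 2 < k \<longrightarrow>
               (\<exists>N X Y. admissible n k N X Y \<and>
                  int N = \<lfloor>(real n + 2 - real k) / real k\<rfloor>)))"
proof (intro conjI impI allI)
  fix N X Y assume "admissible n k N X Y"
  then interpret half_intersecting_family "{1..N}" "{1..n}" "\<lambda>i. X i \<union> Y i" k
    using assms(2) by (rule half_intersecting_family_admissible)
  show "N \<le> n" using fisher_bound by simp
next
  fix N X Y assume n: "n > k * 4 ^ k" and "admissible n k N X Y"
  from this(2) interpret half_intersecting_family "{1..N}" "{1..n}" "\<lambda>i. X i \<union> Y i" k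
    using assms(2) by (rule half_intersecting_family_admissible)
  have "k * (N + 1) \<le> n"
  proof (cases "N > k\<^sup>2 + 2 * k")
    case True
    then show ?thesis using sunflower_bound by simp
  next
    case False
    \<comment> \<open>Below the sunflower threshold the family is so small that the size of n alone
      gives the bound.\<close>
    then have "N + 1 \<le> (k + 1)\<^sup>2" by (simp add: power2_eq_square)
    also have "\<dots> \<le> 4 ^ k" by (rule Suc_squared_le_four_power)
    finally have "k * (N + 1) \<le> k * 4 ^ k" by (rule mult_le_mono2)
    with n show ?thesis by linarith
  qed
  then have "real (k * (N + 1)) \<le> real n" by (simp only: of_nat_le_iff)
  then show "int N \<le> \<lfloor>(real n + 2 - real k) / real k\<rfloor>"
    using assms(2) by (simp add: le_floor_iff field_simps)
next
  assume n: "n > k * 4 ^ k" and r: "n mod k + 2 < k"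
  have "k * 1 \<le> k * 4 ^ k" by (intro mult_le_mono2 one_le_power) simp
  with n have "k \<le> n" by linarith
  then have "n div k \<ge> 1" using assms(2) by (simp add: Suc_le_eq div_greater_zero_iff)
  then obtain N where N: "n div k = N + 1" by (metis add.commute le_Suc_ex)
  then have n_eq: "n = k * (N + 1) + n mod k" by (metis mult_div_mod_eq)
  then have "admissible n k N (\<lambda>_. {1..k}) (\<lambda>i. {i * k + 1..i * k + k})"
    by (intro admissible_sunflower) linarith
  moreover have "\<lfloor>(real n + 2 - real k) / real k\<rfloor> = int N"
  \<comment> \<open>The numerator is kN + (n mod k + 2), whose second summand is below k by
    \<open>r\<close>.\<close>
  proof (rule floor_unique)
    have "real n = real k * (real N + 1) + real (n mod k)"
      using arg_cong[OF n_eq, of real] by (simp only: of_nat_add of_nat_mult of_nat_1)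
    moreover have "real (n mod k) + 2 < real k" using r by linarith
    ultimately show "real_of_int (int N) \<le> (real n + 2 - real k) / real k"
      and "(real n + 2 - real k) / real k < real_of_int (int N) + 1"
      using assms(2) by (simp_all add: field_simps)
  qed
  ultimately show "\<exists>N X Y. admissible n k N X Y \<and>
      int N = \<lfloor>(real n + 2 - real k) / real k\<rfloor>" by metis
qed

end
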